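(* Let $n\ge1$. The association $(\mathcal{G},c)\mapsto\Phi^{\mathcal{G},c}$ restricts to a bijection between closed bichromatic graphs on the set of nodes $\{1,\dots,n\}$ and symmetric closed subsets of $BC_n$.
   Context: Let $V=\mathbb{C}^n$ with canonical basis $(e_i)$, $e^\pm_{ij}=e_i\pm e_j$, and $BC_n=\{\pm e^-_{ij},\pm e^+_{ij}: i\ne j\}\cup\{\pm e_i,\pm2e_i\}$. A subset $\Phi'\subseteq BC_n$ is symmetric if $-\Phi'=\Phi'$, and closed if $(\Phi'+\Phi')\cap BC_n\subseteq\Phi'$, i.e. it contains the sum of any two of its (not necessarily distinct) elements whenever this sum lies in $BC_n$. A bichromatic graph $(\mathcal{G},c)$ on nodes $\{1,\dots,n\}$ has unoriented straight edges $\{i,j\}$ ($i\ne j$) and loop edges $\{k\}$, each coloured red or green, such that two distinct edges with the same underlying node set have different colours. The set $\Phi^{\mathcal{G},c}\subseteq BC_n$ consists exactly of $\pm e^-_{ij}$ for each red straight edge $\{i,j\}$, $\pm e^+_{ij}$ for each green straight edge $\{i,j\}$, $\pm e_k$ for each red loop at $k$, and $\pm2e_k$ for each green loop at $k$. This is a bijection between bichromatic graphs on $\{1,\dots,n\}$ and symmetric subsets of $BC_n$. A bichromatic graph is closed if: (0) for any three distinct nodes $i,j,k$, if there are straight edges $\{i,j\}$, $\{j,k\}$ then there is a straight edge $\{i,k\}$, red if the first two have the same colour and green otherwise; (1) if a node is incident to a green loop edge and a straight edge, then the graph contains also the straight edge of opposite colour with the same endpoints; (2) if the graph contains both a red and a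 green straight edge between two nodes, then it contains green loop edges at both of these nodes; (3) if a node is incident to a red loop edge and a straight edge, then there is a red loop edge at the other end of the straight edge; (4) if two distinct nodes are incident to red loop edges, then both the red and the green straight edge between them are present; (5) if a node is incident to a red loop edge, then it is also incident to a green loop edge. *)

theory Defs
  imports "HOL-Analysis.Analysis"
begin

text \<open>
  The nodes \<open>1, \<dots>, n\<close> are the elements of a finite (hence nonempty) index type \<open>'n\<close> with
  \<open>n = CARD('n)\<close>, and \<open>V\<close> is \<open>complex ^ 'n\<close>.
\<close>

definition e :: "'n::finite \<Rightarrow> complex ^ 'n" where
  "e i = axis i 1"

definition e_plus :: "'n::finite \<Rightarrow> 'n \<Rightarrow> complex ^ 'n" where
  "e_plus i j = e i + e j"

definition e_minus :: "'n::finite \<Rightarrow> 'n \<Rightarrow> complex ^ 'n" where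
  "e_minus i j = e i - e j"

definition BC :: "(complex ^ 'n::finite) set" where
  "BC = {\<alpha>. \<exists>i j. i \<noteq> j \<and> (\<alpha> = e_minus i j \<or> \<alpha> = - e_minus i j)}
      \<union> {\<alpha>. \<exists>i j. i \<noteq> j \<and> (\<alpha> = e_plus i j \<or> \<alpha> = - e_plus i j)}
      \<union> {\<alpha>. \<exists>i. \<alpha> = e i \<or> \<alpha> = - e i}
      \<union> {\<alpha>. \<exists>i. \<alpha> = 2 *s e i \<or> \<alpha> = - (2 *s e i)}"

definition symmetric_subset :: "(complex ^ 'n::finite) set \<Rightarrow> bool" where
  "symmetric_subset S \<longleftrightarrow> S \<subseteq> BC \<and> uminus ` S = S"

definition closed_subset :: "(complex ^ 'n::finite) set \<Rightarrow> bool" where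
  "closed_subset S \<longleftrightarrow> S \<subseteq> BC \<and> {\<alpha> + \<beta> | \<alpha> \<beta>. \<alpha> \<in> S \<and> \<beta> \<in> S} \<inter> BC \<subseteq> S"

datatype colour = Red | Green

fun opposite :: "colour \<Rightarrow> colour" where
  "opposite Red = Green"
| "opposite Green = Red"

text \<open>
  An edge is a pair of its underlying node set (one node for a loop, two nodes for a straight
  edge) and its colour. As a graph is a \<^emph>\<open>set\<close> of such pairs, distinct edges with the same
  underlying node set have different colours.
\<close>

type_synonym 'n coloured_graph = "('n set \<times> colour) set"

definition bichromatic_graph :: "'n coloured_graph \<Rightarrow> bool" where
  "bichromatic_graph G \<longleftrightarrow>
     (\<forall>(A, c) \<in> G. (\<exists>i j. i \<noteq> j \<and> A = {i, j}) \<or> (\<exists>k. A = {k}))"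

definition straight :: "'n coloured_graph \<Rightarrow> colour \<Rightarrow> 'n \<Rightarrow> 'n \<Rightarrow> bool" where
  "straight G c i j \<longleftrightarrow> i \<noteq> j \<and> ({i, j}, c) \<in> G"

definition loop :: "'n coloured_graph \<Rightarrow> colour \<Rightarrow> 'n \<Rightarrow> bool" where
  "loop G c k \<longleftrightarrow> ({k}, c) \<in> G"

definition Phi :: "'n::finite coloured_graph \<Rightarrow> (complex ^ 'n) set" where
  "Phi G = {\<alpha>. \<exists>i j. straight G Red i j \<and> (\<alpha> = e_minus i j \<or> \<alpha> = - e_minus i j)}
         \<union> {\<alpha>. \<exists>i j. straight G Green i j \<and> (\<alpha> = e_plus i j \<or> \<alpha> = - e_plus i j)}
         \<union> {\<alpha>. \<exists>k. loop G Red k \<and> (\<alpha> = e k \<or> \<alpha> = - e k)}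
         \<union> {\<alpha>. \<exists>k. loop G Green k \<and> (\<alpha> = 2 *s e k \<or> \<alpha> = - (2 *s e k))}"

text \<open>
  \<open>straight\<close> is symmetric in its nodes, so quantifying over ordered pairs covers both
  endpoints of an edge.
\<close>

definition closed_graph :: "'n coloured_graph \<Rightarrow> bool" where
  "closed_graph G \<longleftrightarrow>
     (\<forall>i j k c d. i \<noteq> j \<and> j \<noteq> k \<and> i \<noteq> k \<and> straight G c i j \<and> straight G d j k
        \<longrightarrow> straight G (if c = d then Red else Green) i k) \<and>
     (\<forall>i j c. loop G Green i \<and> straight G c i j \<longrightarrow> straight G (opposite c) i j) \<and>
     (\<forall>i j. straight G Red i j \<and> straight G Green i j \<longrightarrow> loop G Green i \<and> loop G Green j) \<and>
     (\<forall>i j c. loop G Red i \<and> straight G c i j \<longrightarrow> loop G Red j) \<and>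
     (\<forall>i j. i \<noteq> j \<and> loop G Red i \<and> loop G Red j
        \<longrightarrow> straight G Red i j \<and> straight G Green i j) \<and>
     (\<forall>i. loop G Red i \<longrightarrow> loop G Green i)"

end

theory Submission imports Defs begin

text \<open>
  Both notions of closedness say that one and the same relation is transitive.

  Add to \<open>V\<close> the signed basis vectors \<open>\<plusminus>e\<^sub>i\<close> and the origin: \<open>2n + 1\<close> points, permuted by
  negation. The elements of \<open>BC\<close> are exactly the differences \<open>x - y\<close> of two distinct points:
  \<open>e\<^sub>i = e\<^sub>i - 0\<close>, \<open>2e\<^sub>i = e\<^sub>i - (-e\<^sub>i)\<close> and \<open>e\<^sub>i + e\<^sub>j = e\<^sub>i - (-e\<^sub>j)\<close>. The only ambiguity in this
  description is \<open>x - y = (-y) - (-x)\<close> (lemma \<open>vec_of_diff_eq_iff\<close>). A symmetric subset \<open>S\<close> is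
  therefore the same thing as a reflexive symmetric relation on the points that is stable under
  negation: \<open>x\<close> and \<open>y\<close> are related if \<open>x = y\<close> or \<open>x - y \<in> S\<close>. A bichromatic graph is this
  relation drawn modulo negation, with \<open>\<Phi>\<close> as the translation, so \<open>\<Phi>\<close> is a bijection from
  bichromatic graphs to symmetric subsets.

  If \<open>S\<close> is closed, then \<open>(x - y) + (y - z) = x - z\<close> makes the relation transitive. Conversely,
  suppose that two roots \<open>x - y\<close> and \<open>z - w\<close> add up to a root. Roots have \<open>\<ell>\<^sup>1\<close>-norm at most 2,
  whereas without cancellation between the two summands the norm of the sum would be at least 3;
  so one point of the first root cancels one of the second (lemma \<open>cancellation\<close>). After
  rewriting one of them by the ambiguity above, the two roots have the form \<open>x - y\<close> and \<open>y - z\<close>,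
  and transitivity applies (lemma \<open>closed_iff_transp_related\<close>).

  On the graph side, transitivity at three distinct points is trivial if they are the origin and
  two opposite points with the origin at an end; otherwise it is one of the six conditions on
  closed graphs, according to which points are the origin or negatives of each other (lemma
  \<open>closed_graph_iff_transp_linked\<close>).
\<close>

section \<open>Signed basis vectors and the origin\<close>

datatype 'n point = Origin | Pos 'n | Neg 'n

fun flip :: "'n point \<Rightarrow> 'n point" where
  "flip Origin = Origin"
| "flip (Pos i) = Neg i"
| "flip (Neg i) = Pos i"

fun vec_of :: "'n::finite point \<Rightarrow> complex ^ 'n" where
  "vec_of Origin = 0"
| "vec_of (Pos i) = e i"
| "vec_of (Neg i) = - e i"

text \<open>
  The \<open>\<ell>\<^sup>1\<close>-norm is the right measure of cancellation here because it is additive on sums of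
  signed basis vectors among which no two are opposite.
\<close>
definition l1 :: "complex ^ 'n::finite \<Rightarrow> real" where
  "l1 u = (\<Sum>k\<in>UNIV. norm (u $ k))"

lemma flip_flip [simp]: "flip (flip x) = x"
  by (cases x) auto

lemma flip_eq_iff: "flip x = y \<longleftrightarrow> x = flip y"
  by auto

lemma vec_of_flip [simp]: "vec_of (flip x) = - vec_of x"
  by (cases x) auto

lemma vec_of_nth: "vec_of x $ k = of_bool (x = Pos k) - of_bool (x = Neg k)"
  by (cases x) (auto simp: e_def axis_def)

lemma vec_of_nth_eq_1_iff: "vec_of x $ k = 1 \<longleftrightarrow> x = Pos k"
  by (cases x) (simp_all add: e_def axis_def)

lemma vec_of_nth_eq_minus_1_iff: "vec_of x $ k = -1 \<longleftrightarrow> x = Neg k"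
  by (cases x) (simp_all add: e_def axis_def)

lemma vec_of_inject [simp]: "vec_of x = vec_of y \<longleftrightarrow> x = y"
  by (metis point.exhaust vec_of_nth_eq_1_iff vec_of_nth_eq_minus_1_iff)

lemma l1_vec_of: "l1 (vec_of x) = of_bool (x \<noteq> Origin)"
proof (cases x)
  case Origin
  then show ?thesis by (simp add: l1_def)
next
  case (Pos i)
  have "l1 (vec_of x) = (\<Sum>k\<in>UNIV. if k = i then 1 else 0)"
    unfolding l1_def by (rule sum.cong) (auto simp: Pos e_def axis_def)
  then show ?thesis by (simp add: Pos)
next
  case (Neg i)
  have "l1 (vec_of x) = (\<Sum>k\<in>UNIV. if k = i then 1 else 0)"
    unfolding l1_def by (rule sum.cong) (auto simp: Neg e_def axis_def)
  then show ?thesis by (simp add: Neg)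
qed

lemma l1_triangle: "l1 (u + w) \<le> l1 u + l1 w"
  unfolding l1_def by (simp add: sum.distrib [symmetric] norm_triangle_ineq sum_mono)

lemma l1_vec_of_diff_le: "l1 (vec_of x - vec_of y) \<le> 2"
proof -
  have "l1 (vec_of x - vec_of y) = l1 (vec_of x + vec_of (flip y))"
    by simp
  also have "\<dots> \<le> l1 (vec_of x) + l1 (vec_of (flip y))"
    by (rule l1_triangle)
  also have "\<dots> \<le> 2"
    unfolding l1_vec_of by simp
  finally show ?thesis .
qed

lemma norm_of_bool: "norm (of_bool a :: complex) = of_bool a"
  by simp

lemma norm_sum_of_bool:
  "norm (of_bool a + of_bool b + of_bool c + of_bool d :: complex)
    = of_bool a + of_bool b + of_bool c + of_bool d"
  by (cases a; cases b; cases c; cases d) simp_all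

text \<open>
  In each coordinate the nonzero contributions all have the same sign, so the \<open>\<ell>\<^sup>1\<close>-norms of the
  four vectors add up. The origin is opposite to itself and hence occurs at most once among the
  points, so at least three of the four norms are 1.
\<close>
lemma l1_no_opposite:
  assumes "x \<noteq> flip y" "x \<noteq> flip z" "x \<noteq> flip w" "y \<noteq> flip z" "y \<noteq> flip w" "z \<noteq> flip w"
  shows "l1 (vec_of x + vec_of y + vec_of z + vec_of w) \<ge> 3"
proof -
  have coord: "norm ((vec_of x + vec_of y + vec_of z + vec_of w) $ k)
      = norm (vec_of x $ k) + norm (vec_of y $ k) + norm (vec_of z $ k) + norm (vec_of w $ k)" for k
  proof -
    have "Pos k \<notin> {x, y, z, w} \<or> Neg k \<notin> {x, y, z, w}"
      using assms by auto
    then show ?thesis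
    proof
      assume "Pos k \<notin> {x, y, z, w}"
      then have nth: "vec_of x $ k = - of_bool (x = Neg k)" "vec_of y $ k = - of_bool (y = Neg k)"
        "vec_of z $ k = - of_bool (z = Neg k)" "vec_of w $ k = - of_bool (w = Neg k)"
        by (auto simp: vec_of_nth)
      have "norm ((vec_of x + vec_of y + vec_of z + vec_of w) $ k)
          = norm (- (of_bool (x = Neg k) + of_bool (y = Neg k) + of_bool (z = Neg k)
              + of_bool (w = Neg k) :: complex))"
        unfolding vector_add_component nth by (simp only: minus_add_distrib)
      then show ?thesis
        unfolding norm_minus_cancel norm_sum_of_bool nth by (simp only: norm_of_bool)
    next
      assume "Neg k \<notin> {x, y, z, w}"
      then have nth: "vec_of x $ k = of_bool (x = Pos k)" "vec_of y $ k = of_bool (y = Pos k)"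
        "vec_of z $ k = of_bool (z = Pos k)" "vec_of w $ k = of_bool (w = Pos k)"
        by (auto simp: vec_of_nth)
      show ?thesis
        unfolding vector_add_component nth norm_sum_of_bool by (simp only: norm_of_bool)
    qed
  qed
  have "l1 (vec_of x + vec_of y + vec_of z + vec_of w)
      = l1 (vec_of x) + l1 (vec_of y) + l1 (vec_of z) + l1 (vec_of w)"
    by (simp only: l1_def coord sum.distrib)
  moreover have "x = Origin \<Longrightarrow> y \<noteq> Origin \<and> z \<noteq> Origin \<and> w \<noteq> Origin"
    "y = Origin \<Longrightarrow> z \<noteq> Origin \<and> w \<noteq> Origin" "z = Origin \<Longrightarrow> w \<noteq> Origin"
    using assms by auto
  ultimately show ?thesis
    unfolding l1_vec_of by (cases "x = Origin"; cases "y = Origin"; cases "z = Origin") simp_all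
qed

text \<open>
  The four alternatives are the ways in which one of \<open>x, -y\<close> can be opposite to one of \<open>z, -w\<close>.
  The bound 2 covers both uses: a sum that is again a root, and a sum that vanishes.
\<close>
lemma cancellation:
  assumes "x \<noteq> y" "z \<noteq> w" "l1 ((vec_of x - vec_of y) + (vec_of z - vec_of w)) \<le> 2"
  shows "y = z \<or> y = flip w \<or> x = w \<or> x = flip z"
proof (rule ccontr)
  assume "\<not> ?thesis"
  then have "l1 (vec_of x + vec_of (flip y) + vec_of z + vec_of (flip w)) \<ge> 3"
    using assms by (intro l1_no_opposite) (auto simp: flip_eq_iff)
  then show False
    using assms(3) by (simp add: algebra_simps)
qed

lemma vec_of_diff_eq_iff:
  assumes "x \<noteq> y" "z \<noteq> w"
  shows "vec_of x - vec_of y = vec_of z - vec_of w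
    \<longleftrightarrow> (x = z \<and> y = w) \<or> (x = flip w \<and> y = flip z)"
proof
  assume eq: "vec_of x - vec_of y = vec_of z - vec_of w"
  then have "(vec_of x - vec_of y) + (vec_of w - vec_of z) = 0"
    by simp
  then consider "y = w" | "y = flip z" | "x = z" | "x = flip w"
    using cancellation [of x y w z] assms by (auto simp: l1_def)
  then show "(x = z \<and> y = w) \<or> (x = flip w \<and> y = flip z)"
  proof cases
    case 1
    then show ?thesis using eq by simp
  next
    case 2
    then have "vec_of x = vec_of (flip w)" using eq by simp
    then have "x = flip w" by (simp only: vec_of_inject)
    then show ?thesis using 2 by simp
  next
    case 3
    then show ?thesis using eq by simp
  next
    case 4
    then have "vec_of (flip y) = vec_of z" using eq by simp
    then have "flip y = z" by (simp only: vec_of_inject)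
    then show ?thesis using 4 by auto
  qed
qed auto

section \<open>Roots as differences of points\<close>

lemma two_e: "2 *s e i = e i + e i"
  by (simp add: vec_eq_iff)

text \<open>
  The graph as a relation on points, chosen so that \<open>x - y\<close> is the root attached to the edge:
  a red edge joins points of equal sign, a green edge points of opposite sign, and a red loop
  joins a point to the origin. A green loop joins the two opposite points of its node. Every
  point is linked to itself, which corresponds to no root.
\<close>
fun linked :: "'n coloured_graph \<Rightarrow> 'n point \<Rightarrow> 'n point \<Rightarrow> bool" where
  "linked G Origin Origin \<longleftrightarrow> True"
| "linked G Origin (Pos i) \<longleftrightarrow> loop G Red i"
| "linked G Origin (Neg i) \<longleftrightarrow> loop G Red i"
| "linked G (Pos i) Origin \<longleftrightarrow> loop G Red i"
| "linked G (Neg i) Origin \<longleftrightarrow> loop G Red i"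
| "linked G (Pos i) (Pos j) \<longleftrightarrow> i = j \<or> straight G Red i j"
| "linked G (Neg i) (Neg j) \<longleftrightarrow> i = j \<or> straight G Red i j"
| "linked G (Pos i) (Neg j) \<longleftrightarrow> (if i = j then loop G Green i else straight G Green i j)"
| "linked G (Neg i) (Pos j) \<longleftrightarrow> (if i = j then loop G Green i else straight G Green i j)"

lemma straight_sym: "straight G c i j \<longleftrightarrow> straight G c j i"
  by (auto simp: straight_def insert_commute)

lemma straight_irrefl [simp]: "\<not> straight G c i i"
  by (simp add: straight_def)

lemma linked_refl [simp]: "linked G x x"
  by (cases x) auto

lemma linked_sym: "linked G x y \<longleftrightarrow> linked G y x"
  by (cases x; cases y) (auto simp: straight_sym)

lemma linked_flip: "linked G (flip x) (flip y) \<longleftrightarrow> linked G x y"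
  by (cases x; cases y) auto

lemma Phi_eq:
  fixes G :: "'n::finite coloured_graph"
  shows "Phi G = {vec_of x - vec_of y | x y. x \<noteq> y \<and> linked G x y}" (is "_ = ?R")
proof (intro equalityI subsetI)
  fix \<alpha>
  assume "\<alpha> \<in> Phi G"
  then consider
      i j where "straight G Red i j" "\<alpha> = e_minus i j" | i j where "straight G Red i j" "\<alpha> = - e_minus i j"
    | i j where "straight G Green i j" "\<alpha> = e_plus i j" | i j where "straight G Green i j" "\<alpha> = - e_plus i j"
    | i where "loop G Red i" "\<alpha> = e i" | i where "loop G Red i" "\<alpha> = - e i"
    | i where "loop G Green i" "\<alpha> = 2 *s e i" | i where "loop G Green i" "\<alpha> = - (2 *s e i)"
    unfolding Phi_def by blast
  then obtain x y where "x \<noteq> y" "linked G x y" "\<alpha> = vec_of x - vec_of y"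
  proof cases
    case (1 i j)
    then show ?thesis by (intro that [of "Pos i" "Pos j"]) (auto simp: e_minus_def)
  next
    case (2 i j)
    then show ?thesis by (intro that [of "Neg i" "Neg j"]) (auto simp: e_minus_def)
  next
    case (3 i j)
    then show ?thesis by (intro that [of "Pos i" "Neg j"]) (auto simp: e_plus_def)
  next
    case (4 i j)
    then show ?thesis by (intro that [of "Neg i" "Pos j"]) (auto simp: e_plus_def)
  next
    case (5 i)
    then show ?thesis by (intro that [of "Pos i" Origin]) auto
  next
    case (6 i)
    then show ?thesis by (intro that [of "Neg i" Origin]) auto
  next
    case (7 i)
    then show ?thesis by (intro that [of "Pos i" "Neg i"]) (auto simp: two_e)
  next
    case (8 i)
    then show ?thesis by (intro that [of "Neg i" "Pos i"]) (auto simp: two_e)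
  qed
  then show "\<alpha> \<in> ?R" by blast
next
  have straight: "straight G Red i j \<Longrightarrow> e i - e j \<in> Phi G"
    "straight G Green i j \<Longrightarrow> e i + e j \<in> Phi G"
    "straight G Green i j \<Longrightarrow> - e i - e j \<in> Phi G" for i j
    unfolding Phi_def e_minus_def e_plus_def by auto
  have loop: "loop G Red i \<Longrightarrow> e i \<in> Phi G" "loop G Red i \<Longrightarrow> - e i \<in> Phi G"
    "loop G Green i \<Longrightarrow> e i + e i \<in> Phi G" "loop G Green i \<Longrightarrow> - e i - e i \<in> Phi G" for i
    unfolding Phi_def two_e by auto
  fix \<alpha>
  assume "\<alpha> \<in> ?R"
  then obtain x y where "x \<noteq> y" "linked G x y" "\<alpha> = vec_of x - vec_of y"
    by blast
  then show "\<alpha> \<in> Phi G"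
    by (cases x; cases y) (auto simp: straight loop [simplified] straight_sym split: if_splits)
qed

text \<open>\<open>BC\<close> is the set of roots of the graph that has all edges, in which any two points are linked.\<close>
lemma BC_eq: "(BC :: (complex ^ 'n::finite) set) = {vec_of x - vec_of y | x y. x \<noteq> y}"
proof -
  have "linked UNIV x y" for x y :: "'n point"
    by (cases x; cases y) (auto simp: straight_def loop_def)
  moreover have "BC = Phi (UNIV :: 'n coloured_graph)"
    unfolding BC_def Phi_def straight_def loop_def by simp
  ultimately show ?thesis by (simp add: Phi_eq)
qed

section \<open>Closed subsets and transitivity\<close>

definition related :: "(complex ^ 'n::finite) set \<Rightarrow> 'n point \<Rightarrow> 'n point \<Rightarrow> bool" where
  "related S x y \<longleftrightarrow> x = y \<or> vec_of x - vec_of y \<in> S"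

lemma symmetric_uminus: "symmetric_subset S \<Longrightarrow> - \<alpha> \<in> S \<longleftrightarrow> \<alpha> \<in> S"
  unfolding symmetric_subset_def by (metis add.inverse_inverse image_eqI)

text \<open>
  Two roots whose sum is a root can always be written as \<open>x - y\<close> and \<open>y - z\<close>, in one order or
  the other, so that closedness and transitivity are about the same pairs.
\<close>
lemma closed_iff_transp_related:
  assumes S: "symmetric_subset S"
  shows "closed_subset S \<longleftrightarrow> transp (related S)"
proof
  assume closed: "closed_subset S"
  show "transp (related S)"
  proof (rule transpI)
    fix x y z
    assume xy: "related S x y" and yz: "related S y z"
    show "related S x z"
    proof (cases "x = y \<or> y = z \<or> x = z")
      case True
      then show ?thesis using xy yz by (auto simp: related_def)
    next
      case False
      then have "vec_of x - vec_of y \<in> S" "vec_of y - vec_of z \<in> S"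
        using xy yz by (auto simp: related_def)
      moreover have "vec_of x - vec_of z = (vec_of x - vec_of y) + (vec_of y - vec_of z)"
        by simp
      moreover have "vec_of x - vec_of z \<in> BC"
        using False unfolding BC_eq by blast
      ultimately have "vec_of x - vec_of z \<in> S"
        using closed unfolding closed_subset_def by blast
      then show ?thesis by (simp add: related_def)
    qed
  qed
next
  assume trans: "transp (related S)"
  \<comment> \<open>That the sum lies in \<open>BC\<close> excludes the case \<open>x = z\<close>, where it vanishes.\<close>
  have chain: "(vec_of x - vec_of y) + (vec_of y - vec_of z) \<in> S"
    if "vec_of x - vec_of y \<in> S" "vec_of y - vec_of z \<in> S"
      "(vec_of x - vec_of y) + (vec_of y - vec_of z) \<in> BC" for x y z
  proof -
    have "related S x z"
      using trans that(1,2) unfolding related_def transp_def by blast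
    moreover have "x \<noteq> z"
      using that(3) unfolding BC_eq by auto
    ultimately show ?thesis by (simp add: related_def)
  qed
  have "\<alpha> + \<beta> \<in> S" if "\<alpha> \<in> S" "\<beta> \<in> S" "\<alpha> + \<beta> \<in> BC" for \<alpha> \<beta>
  proof -
    have "\<alpha> \<in> BC" "\<beta> \<in> BC"
      using S that by (auto simp: symmetric_subset_def)
    then obtain x y z w where xy: "x \<noteq> y" "\<alpha> = vec_of x - vec_of y"
      and zw: "z \<noteq> w" "\<beta> = vec_of z - vec_of w"
      unfolding BC_eq by blast
    have "l1 (\<alpha> + \<beta>) \<le> 2"
      using that(3) l1_vec_of_diff_le unfolding BC_eq by force
    then consider "y = z" | "y = flip w" | "x = w" | "x = flip z"
      using cancellation [OF xy(1) zw(1)] xy zw by auto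
    then show ?thesis
    proof cases
      case 1
      then show ?thesis using chain [of x y w] that xy zw by simp
    next
      case 2
      then have "\<beta> = vec_of y - vec_of (flip z)" using zw by simp
      then show ?thesis using chain [of x y "flip z"] that xy by simp
    next
      case 3
      then show ?thesis using chain [of z x y] that xy zw by (simp add: add.commute)
    next
      case 4
      then have "\<alpha> = vec_of (flip y) - vec_of z" using xy by simp
      then show ?thesis using chain [of "flip y" z w] that zw by simp
    qed
  qed
  then show "closed_subset S"
    using S unfolding closed_subset_def symmetric_subset_def by blast
qed

text \<open>
  An edge can be recovered from its root because the only other way to write \<open>x - y\<close>, namely
  \<open>(-y) - (-x)\<close>, describes the same edge.
\<close>
lemma related_Phi: "related (Phi G) x y \<longleftrightarrow> linked G x y"
proof (cases "x = y")
  case True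
  then show ?thesis by (simp add: related_def)
next
  case False
  have "linked G x y" if "z \<noteq> w" "linked G z w" "vec_of x - vec_of y = vec_of z - vec_of w" for z w
    using that vec_of_diff_eq_iff [OF False that(1)] linked_flip linked_sym by metis
  then show ?thesis
    using False unfolding related_def Phi_eq by blast
qed

lemma symmetric_Phi: "symmetric_subset (Phi G)"
proof -
  have "- \<alpha> \<in> Phi G" if "\<alpha> \<in> Phi G" for \<alpha>
    using that unfolding Phi_eq by (smt (verit) linked_sym mem_Collect_eq minus_diff_eq)
  then have "uminus ` Phi G = Phi G"
    by (metis (no_types, lifting) add.inverse_inverse image_eqI image_subsetI subsetI subset_antisym)
  then show ?thesis
    unfolding symmetric_subset_def by (auto simp: Phi_eq BC_eq)
qed

section \<open>Closed graphs and transitivity\<close>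

text \<open>
  Consider a chain of points \<open>x, y, z\<close>. Three points over distinct nodes give condition (0);
  \<open>\<plusminus>i\<close> as neighbours in the chain, followed by a point over another node, give (1); \<open>\<plusminus>i\<close> as its
  ends, with a point over another node in the middle, give (2). With the origin at one end and
  points over distinct nodes otherwise one gets (3). The origin in the middle gives (4) for
  distinct nodes and (5) for \<open>\<plusminus>i\<close>.
\<close>
lemma closed_graph_iff_transp_linked: "closed_graph G \<longleftrightarrow> transp (linked G)"
proof
  assume G: "closed_graph G"
  have path: "straight G (if c = d then Red else Green) i k"
    if "straight G c i j" "straight G d j k" "i \<noteq> k" for c d i j k
  proof -
    have "i \<noteq> j" "j \<noteq> k" using that by (auto simp: straight_def)
    then show ?thesis using G that unfolding closed_graph_def by blast
  qed
  have path_red: "straight G c i j \<Longrightarrow> straight G c j k \<Longrightarrow> i \<noteq> k \<Longrightarrow> straight G Red i k"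
    for c i j k
    using path [of c i j c k] by simp
  have path_green:
    "straight G Red i j \<Longrightarrow> straight G Green j k \<Longrightarrow> i \<noteq> k \<Longrightarrow> straight G Green i k"
    "straight G Green i j \<Longrightarrow> straight G Red j k \<Longrightarrow> i \<noteq> k \<Longrightarrow> straight G Green i k"
    for i j k
    using path [of Red i j Green k] path [of Green i j Red k] by simp_all
  have green_loop: "straight G (opposite c) i j" if "loop G Green i" "straight G c i j" for c i j
    using G that unfolding closed_graph_def by blast
  have opposite: "straight G Red i j \<longleftrightarrow> straight G Green i j"
    if "loop G Green i \<or> loop G Green j" for i j
    using that green_loop [of i Red j] green_loop [of i Green j]
      green_loop [of j Red i] green_loop [of j Green i]
    by (auto simp: straight_sym [of G _ j i])
  have double_edge: "loop G Green i"
    if "straight G Red i j" "straight G Green i j" for i j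
    using G that unfolding closed_graph_def by blast
  have red_loop: "loop G Red j" if "loop G Red i" "straight G c i j" for c i j
    using G that unfolding closed_graph_def by blast
  have red_loops: "straight G c i j" if "loop G Red i" "loop G Red j" "i \<noteq> j" for c i j
    using G that unfolding closed_graph_def by (cases c) blast+
  have red_green_loop: "loop G Green i" if "loop G Red i" for i
    using G that unfolding closed_graph_def by blast
  show "transp (linked G)"
  proof (rule transpI)
    fix x y z
    assume "linked G x y" "linked G y z"
    then show "linked G x z"
      by (cases x; cases y; cases z; simp split: if_splits)
        (metis path_red path_green opposite double_edge red_loop red_loops red_green_loop
          straight_sym)+
  qed
next
  assume "transp (linked G)"
  then have trans: "linked G x z" if "linked G x y" "linked G y z" for x y z
    using that by (rule transpD)
  show "closed_graph G"
    unfolding closed_graph_def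
  proof (intro conjI allI impI; (elim conjE)?)
    fix i j k c d
    assume "i \<noteq> j" "j \<noteq> k" "i \<noteq> k" "straight G c i j" "straight G d j k"
    then show "straight G (if c = d then Red else Green) i k"
      using trans [of "Pos i" "Pos j" "Pos k"] trans [of "Pos i" "Pos j" "Neg k"]
        trans [of "Pos i" "Neg j" "Pos k"] trans [of "Pos i" "Neg j" "Neg k"]
      by (cases c; cases d) auto
  next
    fix i j c
    assume "loop G Green i" "straight G c i j"
    moreover from this have "i \<noteq> j" by (auto simp: straight_def)
    ultimately show "straight G (opposite c) i j"
      using trans [of "Pos i" "Neg i" "Pos j"] trans [of "Pos i" "Neg i" "Neg j"]
      by (cases c) auto
  next
    fix i j
    assume edges: "straight G Red i j" "straight G Green i j"
    then have "i \<noteq> j" by (auto simp: straight_def)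
    then show "loop G Green i" "loop G Green j"
      using edges trans [of "Pos i" "Pos j" "Neg i"] trans [of "Pos j" "Pos i" "Neg j"]
      by (auto simp: straight_sym [of G _ j i])
  next
    fix i j c
    assume "loop G Red i" "straight G c i j"
    moreover from this have "i \<noteq> j" by (auto simp: straight_def)
    ultimately show "loop G Red j"
      using trans [of Origin "Pos i" "Pos j"] trans [of Origin "Pos i" "Neg j"]
      by (cases c) auto
  next
    fix i j
    assume "i \<noteq> j" "loop G Red i" "loop G Red j"
    then show "straight G Red i j" "straight G Green i j"
      using trans [of "Pos i" Origin "Pos j"] trans [of "Pos i" Origin "Neg j"] by auto
  next
    fix i
    assume "loop G Red i"
    then show "loop G Green i"
      using trans [of "Pos i" Origin "Neg i"] by simp
  qed
qed

section \<open>Recovering the graph from its roots\<close>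

definition graph_of :: "(complex ^ 'n::finite) set \<Rightarrow> 'n coloured_graph" where
  "graph_of S =
     {({i, j}, Red) | i j. i \<noteq> j \<and> related S (Pos i) (Pos j)}
   \<union> {({i, j}, Green) | i j. i \<noteq> j \<and> related S (Pos i) (Neg j)}
   \<union> {({k}, Red) | k. related S (Pos k) Origin}
   \<union> {({k}, Green) | k. related S (Pos k) (Neg k)}"

lemma related_sym:
  assumes "symmetric_subset S"
  shows "related S x y \<longleftrightarrow> related S y x"
  using symmetric_uminus [OF assms, of "vec_of x - vec_of y"] unfolding related_def by auto

lemma related_flip:
  assumes "symmetric_subset S"
  shows "related S (flip x) (flip y) \<longleftrightarrow> related S x y"
proof -
  have "vec_of (flip x) - vec_of (flip y) = - (vec_of x - vec_of y)"
    by simp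
  then have "vec_of (flip x) - vec_of (flip y) \<in> S \<longleftrightarrow> vec_of x - vec_of y \<in> S"
    by (simp only: symmetric_uminus [OF assms])
  moreover have "flip x = flip y \<longleftrightarrow> x = y"
    by (metis flip_flip)
  ultimately show ?thesis
    unfolding related_def by blast
qed

lemma bichromatic_graph_of: "bichromatic_graph (graph_of S)"
proof -
  have "(\<exists>i j. i \<noteq> j \<and> A = {i, j}) \<or> (\<exists>k. A = {k})" if "(A, c) \<in> graph_of S" for A c
    using that unfolding graph_of_def by (elim UnE CollectE exE conjE Pair_inject) blast+
  then show ?thesis
    unfolding bichromatic_graph_def by blast
qed

lemma straight_graph_of:
  assumes "symmetric_subset S"
  shows "straight (graph_of S) Red i j \<longleftrightarrow> i \<noteq> j \<and> related S (Pos i) (Pos j)"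
    and "straight (graph_of S) Green i j \<longleftrightarrow> i \<noteq> j \<and> related S (Pos i) (Neg j)"
proof -
  have "straight (graph_of S) Red i j
      \<longleftrightarrow> i \<noteq> j \<and> (related S (Pos i) (Pos j) \<or> related S (Pos j) (Pos i))"
    by (auto simp: straight_def graph_of_def doubleton_eq_iff)
  then show "straight (graph_of S) Red i j \<longleftrightarrow> i \<noteq> j \<and> related S (Pos i) (Pos j)"
    using related_sym [OF assms, of "Pos i" "Pos j"] by blast
  have "straight (graph_of S) Green i j
      \<longleftrightarrow> i \<noteq> j \<and> (related S (Pos i) (Neg j) \<or> related S (Pos j) (Neg i))"
    by (auto simp: straight_def graph_of_def doubleton_eq_iff)
  moreover have "related S (Pos j) (Neg i) \<longleftrightarrow> related S (Pos i) (Neg j)"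
    using related_sym [OF assms, of "Pos j" "Neg i"] related_flip [OF assms, of "Pos i" "Neg j"]
    unfolding flip.simps by blast
  ultimately show "straight (graph_of S) Green i j \<longleftrightarrow> i \<noteq> j \<and> related S (Pos i) (Neg j)"
    by blast
qed

lemma loop_graph_of:
  "loop (graph_of S) Red k \<longleftrightarrow> related S (Pos k) Origin"
  "loop (graph_of S) Green k \<longleftrightarrow> related S (Pos k) (Neg k)"
  by (auto simp: loop_def graph_of_def)

text \<open>
  \<open>graph_of\<close> looks at pairs of points whose first one is positive. Flipping both points accounts
  for a negative first point, and swapping them for the origin in first place.
\<close>
lemma linked_graph_of:
  assumes "symmetric_subset S"
  shows "linked (graph_of S) x y \<longleftrightarrow> related S x y"
proof -
  note sym = related_sym [OF assms] and flip = related_flip [OF assms]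
  have refl: "related S z z" for z
    by (simp add: related_def)
  have pos: "linked (graph_of S) (Pos i) z \<longleftrightarrow> related S (Pos i) z" for i z
    by (cases z) (auto simp: refl straight_graph_of [OF assms] loop_graph_of)
  have neg: "linked (graph_of S) (Neg i) z \<longleftrightarrow> related S (Neg i) z" for i z
    using pos [of i "flip z"] flip [of "Pos i" "flip z"] linked_flip [of "graph_of S" "Pos i" "flip z"]
    by simp
  show ?thesis
  proof (cases x)
    case Origin
    then show ?thesis
      by (metis linked_refl linked_sym neg point.exhaust pos refl sym)
  qed (simp_all add: pos neg)
qed

text \<open>
  A bichromatic graph has only straight edges and loops, so it is determined by the predicates
  \<open>straight\<close> and \<open>loop\<close>.
\<close>
lemma graph_of_Phi:
  assumes "bichromatic_graph G"
  shows "graph_of (Phi G) = G"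
proof -
  have mem: "(A, c) \<in> H
      \<longleftrightarrow> (\<exists>i j. A = {i, j} \<and> straight H c i j) \<or> (\<exists>k. A = {k} \<and> loop H c k)"
    if "bichromatic_graph H" for H :: "'a coloured_graph" and A c
  proof -
    have "(\<exists>i j. i \<noteq> j \<and> A = {i, j}) \<or> (\<exists>k. A = {k})" if "(A, c) \<in> H"
      using \<open>bichromatic_graph H\<close> that unfolding bichromatic_graph_def by blast
    then show ?thesis
      unfolding straight_def loop_def by blast
  qed
  have "straight (graph_of (Phi G)) c i j \<longleftrightarrow> straight G c i j" for c i j
    by (cases c) (auto simp: straight_graph_of [OF symmetric_Phi] related_Phi)
  moreover have "loop (graph_of (Phi G)) c k \<longleftrightarrow> loop G c k" for c k
    by (cases c) (auto simp: loop_graph_of related_Phi)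
  ultimately have "(A, c) \<in> graph_of (Phi G) \<longleftrightarrow> (A, c) \<in> G" for A c
    by (simp add: mem [OF bichromatic_graph_of] mem [OF assms])
  then show ?thesis by auto
qed

lemma Phi_graph_of:
  assumes S: "symmetric_subset S"
  shows "Phi (graph_of S) = S"
proof -
  have "S = {vec_of x - vec_of y | x y. x \<noteq> y \<and> related S x y}"
    using S unfolding symmetric_subset_def related_def BC_eq by blast
  then show ?thesis
    using linked_graph_of [OF S] unfolding Phi_eq by simp
qed

text \<open>Both sides are transitivity of the same relation, by lemma \<open>related_Phi\<close>.\<close>
lemma closed_Phi_iff: "closed_subset (Phi G) \<longleftrightarrow> closed_graph G"
  unfolding closed_iff_transp_related [OF symmetric_Phi] closed_graph_iff_transp_linked
  by (simp add: related_Phi transp_def)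

theorem theorem8p1p3:
  "bij_betw (Phi :: 'n::finite coloured_graph \<Rightarrow> (complex ^ 'n) set)
     {G. bichromatic_graph G \<and> closed_graph G}
     {S. symmetric_subset S \<and> closed_subset S}"
proof (rule bij_betw_byWitness [where f' = graph_of])
  show "Phi ` {G. bichromatic_graph G \<and> closed_graph G} \<subseteq> {S. symmetric_subset S \<and> closed_subset S}"
    by (auto simp: symmetric_Phi closed_Phi_iff)
  show "graph_of ` {S. symmetric_subset S \<and> closed_subset S}
      \<subseteq> {G. bichromatic_graph G \<and> closed_graph G}"
    by (auto simp: bichromatic_graph_of closed_Phi_iff [symmetric] Phi_graph_of)
qed (simp_all add: graph_of_Phi Phi_graph_of)

end
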